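(* Assume that $\Phi$ has a unique minimizer $\theta^*$ on $\Theta$, and let $C$ be the support cone to $\Theta$ at $\theta^*$. Let $(\hat\theta_n)_{n\ge 1}$ be a sequence of random variables with values in $\Theta$ such that, with probability $1$, $\hat\theta_n$ is a minimizer of $\Phi_n$ on $\Theta$ for all large enough $n$. Assume that $\phi(\cdot,\theta)\in L^2(P)$ for all $\theta\in\Theta_0$ and that $h_{\partial\Phi(\theta^* )}(t)>0$ for all $t\in C\setminus\{0\}$. Then $\mathbb P(\hat\theta_n=\theta^* )\to1$ as $n\to\infty$.
   Context: All random variables are defined on a fixed probability space $(\Omega,\mathcal F,\mathbb P)$. $X_1,X_2,\ldots$ are iid random variables with values in a measurable space $E$, with distribution $P$. $\Theta_0\subseteq\mathbb R^d$ is a fixed open convex set and $\Theta$ is a closed convex subset of $\Theta_0$. The loss $\phi:E\times\Theta_0\to\mathbb R$ is measurable in its first argument, convex in its second argument, and $\phi(\cdot,\theta)\in L^1(P)$ for all $\theta\in\Theta_0$. For $\theta\in\Theta_0$ and $n\ge1$, $\Phi(\theta)=\mathbb E[\phi(X_1,\theta)]$ and $\Phi_n(\theta)=\frac1n\sum_{i=1}^n\phi(X_i,\theta)$. $\partial\Phi(\theta^* )$ is the set of all subgradients of $\Phi$ at $\theta^*$, i.e. all $u\in\mathbb R^d$ with $\Phi(\theta)\ge\Phi(\theta^* )+u^\top(\theta-\theta^* )$ for all $\theta\in\Theta_0$. For a non-empty convex set $A\subseteq\mathbb R^d$, its support function is $h_A(t)=\sup_{u\in A}u^\top t$. The tangent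 cone to a closed convex set $G$ at $x_0\in G$ is the set of all $t\in\mathbb R^d$ such that $x_0+\varepsilon t\in G$ for all small enough $\varepsilon>0$; its closure is called the support cone to $G$ at $x_0$. *)

theory Defs
  imports "HOL-Probability.Probability"
begin

definition risk :: "'w measure \<Rightarrow> (nat \<Rightarrow> 'w \<Rightarrow> 'e) \<Rightarrow> ('e \<Rightarrow> 'v \<Rightarrow> real) \<Rightarrow> 'v \<Rightarrow> real" where
  "risk M X \<phi> \<theta> = prob_space.expectation M (\<lambda>\<omega>. \<phi> (X 1 \<omega>) \<theta>)"

definition empirical_risk ::
    "(nat \<Rightarrow> 'w \<Rightarrow> 'e) \<Rightarrow> ('e \<Rightarrow> 'v \<Rightarrow> real) \<Rightarrow> nat \<Rightarrow> 'w \<Rightarrow> 'v \<Rightarrow> real" where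
  "empirical_risk X \<phi> n \<omega> \<theta> = (1 / real n) * (\<Sum>i=1..n. \<phi> (X i \<omega>) \<theta>)"

definition subdifferential ::
    "'v::real_inner set \<Rightarrow> ('v \<Rightarrow> real) \<Rightarrow> 'v \<Rightarrow> 'v set" where
  "subdifferential D f x = {u. \<forall>y\<in>D. f y \<ge> f x + u \<bullet> (y - x)}"

(* Extended-real valued, since the supremum is infinite in some directions when A is unbounded. *)
definition support_function :: "'v::real_inner set \<Rightarrow> 'v \<Rightarrow> ereal" where
  "support_function A t = (SUP u\<in>A. ereal (u \<bullet> t))"

definition tangent_cone :: "'v::real_normed_vector set \<Rightarrow> 'v \<Rightarrow> 'v set" where
  "tangent_cone G x = {t. \<forall>\<^sub>F \<epsilon> in at_right (0::real). x + \<epsilon> *\<^sub>R t \<in> G}"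

definition support_cone :: "'v::real_normed_vector set \<Rightarrow> 'v \<Rightarrow> 'v set" where
  "support_cone G x = closure (tangent_cone G x)"

end

theory Submission
  imports Defs
begin

text \<open>
  Everything is read off the directional derivatives at \<open>\<theta>s\<close>. For a convex loss,
  \<open>t \<mapsto> \<phi>'(x, \<theta>s; t)\<close> is sublinear and bounds the increment of the loss from below:
  \<open>\<phi>(x, \<theta>s + r t) - \<phi>(x, \<theta>s) \<ge> r \<phi>'(x, \<theta>s; t)\<close>. Hence, as soon as the empirical average
  \<open>g\<^sub>n(t)\<close> of \<open>\<phi>'(X\<^sub>i, \<theta>s; t)\<close> is positive on every unit vector \<open>t\<close> of the support cone \<open>C\<close>, the
  point \<open>\<theta>s\<close> is the strict minimizer of the empirical risk on \<open>\<Theta>\<close>, and any minimizer must equal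
  it. Convexity makes this local information at \<open>\<theta>s\<close> decide the minimization over all of \<open>\<Theta>\<close>.

  The expectation \<open>G(t)\<close> of \<open>\<phi>'(X\<^sub>1, \<theta>s; t)\<close> dominates \<open>u \<bullet> t\<close> for every subgradient \<open>u\<close> of the
  risk (\<open>expectation_dir_deriv_ge\<close>), so by hypothesis it is positive on \<open>C - {0}\<close>. For a single
  \<open>t\<close>, the weak law gives \<open>g\<^sub>n(t) \<rightarrow> G(t)\<close> in probability; this is where square integrability
  enters. To pass from single directions to the whole compact set of unit vectors of \<open>C\<close>,
  \<open>sublinear_positive_finite_test\<close> shows that a sublinear function close to \<open>G\<close> at finitely many
  well chosen points is positive on that set: its values on the signed basis vectors control its
  modulus of continuity, and a finite net does the rest. So positivity of \<open>g\<^sub>n\<close> fails with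
  probability tending to 0.

  One measure-theoretic point needs care: the event that \<open>\<theta>hat n\<close> minimizes the empirical risk
  need not be measurable. The event that \<open>\<theta>hat n \<noteq> \<theta>s\<close> although \<open>g\<^sub>n\<close> is good at all the test
  points is measurable, and almost every \<open>\<omega>\<close> belongs to it for only finitely many \<open>n\<close>; dominated
  convergence shows that its probability tends to 0.
\<close>

section \<open>Directional derivatives of convex functions\<close>

definition dir_deriv :: "('v::real_normed_vector \<Rightarrow> real) \<Rightarrow> 'v \<Rightarrow> 'v \<Rightarrow> real" where
  "dir_deriv f x t = Lim (at_right 0) (\<lambda>\<epsilon>. (f (x + \<epsilon> *\<^sub>R t) - f x) / \<epsilon>)"

text \<open>
  For \<open>\<epsilon> \<le> \<eta>\<close> the point \<open>x + \<epsilon> t\<close> is the convex combination of \<open>x\<close> and \<open>x + \<eta> t\<close> with weight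
  \<open>\<epsilon> / \<eta>\<close> on the latter.
\<close>

lemma convex_on_difference_quotient_mono:
  assumes f: "convex_on S f" and S: "x \<in> S" "x + \<eta> *\<^sub>R t \<in> S" and \<epsilon>: "0 < \<epsilon>" "\<epsilon> \<le> \<eta>"
  shows "(f (x + \<epsilon> *\<^sub>R t) - f x) / \<epsilon> \<le> (f (x + \<eta> *\<^sub>R t) - f x) / \<eta>"
proof -
  have \<eta>: "\<eta> > 0" using \<epsilon> by simp
  have "f ((1 - \<epsilon> / \<eta>) *\<^sub>R x + (\<epsilon> / \<eta>) *\<^sub>R (x + \<eta> *\<^sub>R t)) \<le> (1 - \<epsilon> / \<eta>) * f x + (\<epsilon> / \<eta>) * f (x + \<eta> *\<^sub>R t)"
    using f S \<epsilon> \<eta> by (intro convex_onD) auto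
  moreover have "(1 - \<epsilon> / \<eta>) *\<^sub>R x + (\<epsilon> / \<eta>) *\<^sub>R (x + \<eta> *\<^sub>R t) = x + \<epsilon> *\<^sub>R t"
    using \<eta> by (simp add: scaleR_left_diff_distrib scaleR_add_right)
  ultimately have "f (x + \<epsilon> *\<^sub>R t) - f x \<le> \<epsilon> * ((f (x + \<eta> *\<^sub>R t) - f x) / \<eta>)"
    using \<eta> by (simp add: field_simps)
  then show ?thesis using \<epsilon> by (simp add: pos_divide_le_eq mult.commute)
qed

text \<open>
  The point \<open>x\<close> lies between \<open>x - \<eta> t\<close> and \<open>x + \<epsilon> t\<close>. The backward quotients bound the forward
  ones from below; this makes the directional derivative finite and later supplies an integrable
  lower envelope for the forward quotients.
\<close>

lemma convex_on_difference_quotient_ge: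
  assumes f: "convex_on S f" and S: "x - \<eta> *\<^sub>R t \<in> S" "x + \<epsilon> *\<^sub>R t \<in> S" and pos: "0 < \<epsilon>" "0 < \<eta>"
  shows "(f x - f (x - \<eta> *\<^sub>R t)) / \<eta> \<le> (f (x + \<epsilon> *\<^sub>R t) - f x) / \<epsilon>"
proof -
  define s where "s = \<eta> / (\<epsilon> + \<eta>)"
  have s: "0 \<le> s" "s \<le> 1" "(1 - s) * \<eta> = s * \<epsilon>"
    using pos by (auto simp: s_def field_simps)
  have "f ((1 - s) *\<^sub>R (x - \<eta> *\<^sub>R t) + s *\<^sub>R (x + \<epsilon> *\<^sub>R t)) \<le> (1 - s) * f (x - \<eta> *\<^sub>R t) + s * f (x + \<epsilon> *\<^sub>R t)"
    using f S s by (intro convex_onD) auto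
  moreover have "(1 - s) *\<^sub>R (x - \<eta> *\<^sub>R t) + s *\<^sub>R (x + \<epsilon> *\<^sub>R t) = x - ((1 - s) * \<eta>) *\<^sub>R t + (s * \<epsilon>) *\<^sub>R t"
    by (simp add: algebra_simps)
  ultimately have "f x \<le> (1 - s) * f (x - \<eta> *\<^sub>R t) + s * f (x + \<epsilon> *\<^sub>R t)"
    by (simp add: s(3))
  moreover have "1 - s = \<epsilon> / (\<epsilon> + \<eta>)" using pos by (simp add: s_def field_simps)
  ultimately have "f x \<le> (\<epsilon> * f (x - \<eta> *\<^sub>R t) + \<eta> * f (x + \<epsilon> *\<^sub>R t)) / (\<epsilon> + \<eta>)"
    by (simp add: s_def add_divide_distrib)
  then have "(\<epsilon> + \<eta>) * f x \<le> \<epsilon> * f (x - \<eta> *\<^sub>R t) + \<eta> * f (x + \<epsilon> *\<^sub>R t)"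
    using pos by (simp add: pos_le_divide_eq mult.commute)
  then show ?thesis using pos by (simp add: field_simps)
qed

lemma open_contains_small_segment:
  fixes x t :: "'v::real_normed_vector"
  assumes "open S" "x \<in> S"
  obtains \<eta> where "\<eta> > 0" "\<And>\<epsilon>. \<bar>\<epsilon>\<bar> \<le> \<eta> \<Longrightarrow> x + \<epsilon> *\<^sub>R t \<in> S"
proof -
  obtain r where r: "r > 0" "ball x r \<subseteq> S" using assms openE by blast
  define N where "N = norm t + 1"
  have N: "N > 0" "norm t \<le> N" by (auto simp: N_def add_nonneg_pos)
  define \<eta> where "\<eta> = r / 2 / N"
  have "\<eta> > 0" using r(1) N by (simp add: \<eta>_def)
  moreover have "x + \<epsilon> *\<^sub>R t \<in> S" if "\<bar>\<epsilon>\<bar> \<le> \<eta>" for \<epsilon>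
  proof -
    have "norm (\<epsilon> *\<^sub>R t) \<le> \<eta> * N" using that N by (auto intro!: mult_mono)
    also have "\<dots> = r / 2" using N by (simp add: \<eta>_def)
    finally have "dist x (x + \<epsilon> *\<^sub>R t) < r" using r(1) by (simp add: dist_norm)
    then show ?thesis using r(2) by auto
  qed
  ultimately show ?thesis by (rule that)
qed

text \<open>A monotone function that is bounded below has a right limit.\<close>

lemma tendsto_dir_deriv:
  assumes f: "convex_on S f" and S: "open S" "x \<in> S"
  shows "((\<lambda>\<epsilon>. (f (x + \<epsilon> *\<^sub>R t) - f x) / \<epsilon>) \<longlongrightarrow> dir_deriv f x t) (at_right 0)"
proof -
  obtain \<eta> where \<eta>: "\<eta> > 0" "\<And>\<epsilon>. \<bar>\<epsilon>\<bar> \<le> \<eta> \<Longrightarrow> x + \<epsilon> *\<^sub>R t \<in> S"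
    using open_contains_small_segment S by blast
  let ?q = "\<lambda>\<epsilon>. (f (x + \<epsilon> *\<^sub>R t) - f x) / \<epsilon>"
  have "(?q \<longlongrightarrow> Inf (?q ` ({0<..} \<inter> {..<\<eta>}))) (at 0 within ({0<..} \<inter> {..<\<eta>}))"
  proof (rule Lim_right_bound)
    fix a b :: real assume "a \<in> {..<\<eta>}" "b \<in> {..<\<eta>}" "0 < a" "a \<le> b"
    then show "?q a \<le> ?q b"
      using S \<eta> by (intro convex_on_difference_quotient_mono[OF f]) auto
  next
    fix a :: real assume "a \<in> {..<\<eta>}" "0 < a"
    then show "(f x - f (x - \<eta> *\<^sub>R t)) / \<eta> \<le> ?q a"
      using \<eta>(1) \<eta>(2)[of a] \<eta>(2)[of "-\<eta>"] by (intro convex_on_difference_quotient_ge[OF f]) auto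
  qed
  moreover have "at 0 within ({0<..} \<inter> {..<\<eta>}) = at_right (0::real)"
    using \<eta>(1) by (intro at_within_nhd[where S="{..<\<eta>}"]) auto
  ultimately have "(?q \<longlongrightarrow> Inf (?q ` ({0<..} \<inter> {..<\<eta>}))) (at_right 0)" by simp
  then show ?thesis unfolding dir_deriv_def using tendsto_Lim[OF trivial_limit_at_right_real] by force
qed

lemma dir_deriv_le_difference_quotient:
  assumes f: "convex_on S f" and S: "open S" "x \<in> S" "x + \<eta> *\<^sub>R t \<in> S" and "\<eta> > 0"
  shows "dir_deriv f x t \<le> (f (x + \<eta> *\<^sub>R t) - f x) / \<eta>"
proof (rule tendsto_upperbound[OF tendsto_dir_deriv[OF f S(1,2)]])
  show "\<forall>\<^sub>F \<epsilon> in at_right 0. (f (x + \<epsilon> *\<^sub>R t) - f x) / \<epsilon> \<le> (f (x + \<eta> *\<^sub>R t) - f x) / \<eta>"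
    using eventually_at_right_less[of 0] eventually_at_right_real[OF \<open>\<eta> > 0\<close>]
    by eventually_elim (use S in \<open>auto intro!: convex_on_difference_quotient_mono[OF f]\<close>)
qed simp

lemma dir_deriv_ge_difference_quotient:
  assumes f: "convex_on S f" and S: "open S" "x \<in> S" "x - \<eta> *\<^sub>R t \<in> S" and "\<eta> > 0"
  shows "(f x - f (x - \<eta> *\<^sub>R t)) / \<eta> \<le> dir_deriv f x t"
proof (rule tendsto_lowerbound[OF tendsto_dir_deriv[OF f S(1,2)]])
  obtain r where r: "r > 0" "\<And>\<epsilon>. \<bar>\<epsilon>\<bar> \<le> r \<Longrightarrow> x + \<epsilon> *\<^sub>R t \<in> S"
    using open_contains_small_segment S by blast
  show "\<forall>\<^sub>F \<epsilon> in at_right 0. (f x - f (x - \<eta> *\<^sub>R t)) / \<eta> \<le> (f (x + \<epsilon> *\<^sub>R t) - f x) / \<epsilon>"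
    using eventually_at_right_real[OF \<open>r > 0\<close>]
    by eventually_elim (use S r \<open>\<eta> > 0\<close> in \<open>auto intro!: convex_on_difference_quotient_ge[OF f]\<close>)
qed simp

section \<open>Sublinear functionals\<close>

definition sublinear :: "('v::real_vector \<Rightarrow> real) \<Rightarrow> bool" where
  "sublinear g \<longleftrightarrow> (\<forall>s t. g (s + t) \<le> g s + g t) \<and> (\<forall>c t. c \<ge> 0 \<longrightarrow> g (c *\<^sub>R t) = c * g t)"

lemma sublinear_add: "sublinear g \<Longrightarrow> g (s + t) \<le> g s + g t"
  and sublinear_scale: "sublinear g \<Longrightarrow> c \<ge> 0 \<Longrightarrow> g (c *\<^sub>R t) = c * g t"
  by (auto simp: sublinear_def)

lemma sublinear_sum_le:
  assumes g: "sublinear g"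
  shows "g (\<Sum>i\<in>A. v i) \<le> (\<Sum>i\<in>A. g (v i))"
proof (induction A rule: infinite_finite_induct)
  case (insert i A)
  then show ?case using sublinear_add[OF g, of "v i" "\<Sum>i\<in>A. v i"] by simp
qed (use sublinear_scale[OF g, of 0 0] in auto)

text \<open>
  Midpoint convexity at step \<open>2 \<epsilon>\<close> bounds the quotient in direction \<open>s + t\<close> by the sum of the
  quotients in directions \<open>s\<close> and \<open>t\<close>, and this survives the limit. Homogeneity is a rescaling of
  the step.
\<close>

lemma sublinear_dir_deriv:
  assumes f: "convex_on S f" and S: "open S" "x \<in> S"
  shows "sublinear (dir_deriv f x)"
proof -
  note lim = tendsto_dir_deriv[OF f S]
  have resc: "filterlim (\<lambda>\<epsilon>. c * \<epsilon>) (at_right 0) (at_right (0::real))" if "c > 0" for c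
    unfolding filterlim_at using that
    by (auto intro!: tendsto_eq_intros simp: eventually_at_right_less eventually_at_filter)
  show ?thesis
    unfolding sublinear_def
  proof (intro conjI allI impI)
    let ?q = "\<lambda>t \<epsilon>. (f (x + \<epsilon> *\<^sub>R t) - f x) / \<epsilon>"
    fix s t
    obtain a where a: "a > 0" "\<And>\<epsilon>. \<bar>\<epsilon>\<bar> \<le> a \<Longrightarrow> x + \<epsilon> *\<^sub>R s \<in> S"
      using open_contains_small_segment S by blast
    obtain b where b: "b > 0" "\<And>\<epsilon>. \<bar>\<epsilon>\<bar> \<le> b \<Longrightarrow> x + \<epsilon> *\<^sub>R t \<in> S"
      using open_contains_small_segment S by blast
    have "((\<lambda>\<epsilon>. ?q s (2 * \<epsilon>) + ?q t (2 * \<epsilon>)) \<longlongrightarrow> dir_deriv f x s + dir_deriv f x t) (at_right 0)"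
      by (intro tendsto_add filterlim_compose[OF lim resc]) auto
    then show "dir_deriv f x (s + t) \<le> dir_deriv f x s + dir_deriv f x t"
    proof (rule tendsto_le[OF trivial_limit_at_right_real _ lim])
      have "\<forall>\<^sub>F \<epsilon> in at_right 0. \<epsilon> < min a b / 2 \<and> 0 < \<epsilon>"
        using eventually_at_right_real[of 0 "min a b / 2"] a(1) b(1)
        by (auto elim!: eventually_mono)
      then show "\<forall>\<^sub>F \<epsilon> in at_right 0. ?q (s + t) \<epsilon> \<le> ?q s (2 * \<epsilon>) + ?q t (2 * \<epsilon>)"
      proof eventually_elim
        case (elim \<epsilon>)
        have "f ((1 - 1/2) *\<^sub>R (x + (2 * \<epsilon>) *\<^sub>R s) + (1/2) *\<^sub>R (x + (2 * \<epsilon>) *\<^sub>R t))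
            \<le> (1 - 1/2) * f (x + (2 * \<epsilon>) *\<^sub>R s) + (1/2) * f (x + (2 * \<epsilon>) *\<^sub>R t)"
          using a(2)[of "2 * \<epsilon>"] b(2)[of "2 * \<epsilon>"] elim by (intro convex_onD[OF f]) auto
        moreover have "(1 - 1/2) *\<^sub>R (x + (2 * \<epsilon>) *\<^sub>R s) + (1/2) *\<^sub>R (x + (2 * \<epsilon>) *\<^sub>R t)
            = x + \<epsilon> *\<^sub>R (s + t)"
          by (simp add: algebra_simps flip: scaleR_add_left)
        ultimately have "2 * (f (x + \<epsilon> *\<^sub>R (s + t)) - f x)
            \<le> (f (x + (2 * \<epsilon>) *\<^sub>R s) - f x) + (f (x + (2 * \<epsilon>) *\<^sub>R t) - f x)"
          by simp
        then have "2 * (f (x + \<epsilon> *\<^sub>R (s + t)) - f x) / (2 * \<epsilon>)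
            \<le> ((f (x + (2 * \<epsilon>) *\<^sub>R s) - f x) + (f (x + (2 * \<epsilon>) *\<^sub>R t) - f x)) / (2 * \<epsilon>)"
          using elim by (intro divide_right_mono) auto
        then show ?case
          unfolding add_divide_distrib by (subst (asm) mult_divide_mult_cancel_left) auto
      qed
    qed
  next
    fix c :: real and t assume "c \<ge> 0"
    show "dir_deriv f x (c *\<^sub>R t) = c * dir_deriv f x t"
    proof (cases "c = 0")
      case True
      have "((\<lambda>\<epsilon>::real. 0) \<longlongrightarrow> dir_deriv f x 0) (at_right 0)"
        using lim[of 0] by simp
      then show ?thesis using True by (simp add: tendsto_const_iff)
    next
      case False
      with \<open>c \<ge> 0\<close> have c: "c > 0" by simp
      have "((\<lambda>\<epsilon>. c * ((f (x + (c * \<epsilon>) *\<^sub>R t) - f x) / (c * \<epsilon>))) \<longlongrightarrow> c * dir_deriv f x t) (at_right 0)"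
        by (intro tendsto_mult tendsto_const filterlim_compose[OF lim resc] c)
      then have "((\<lambda>\<epsilon>. (f (x + \<epsilon> *\<^sub>R (c *\<^sub>R t)) - f x) / \<epsilon>) \<longlongrightarrow> c * dir_deriv f x t) (at_right 0)"
        using c by (simp add: mult.commute)
      then show ?thesis using tendsto_unique[OF trivial_limit_at_right_real lim] by blast
    qed
  qed
qed

text \<open>
  Expand \<open>v\<close> in the basis and split each coordinate by its sign. Together with
  \<open>g s - g t \<le> g (s - t)\<close> this turns bounds at finitely many points into a Lipschitz constant, which
  is what makes pointwise convergence of sublinear functions locally uniform.
\<close>

lemma sublinear_le_norm:
  fixes g :: "'v::euclidean_space \<Rightarrow> real"
  assumes g: "sublinear g" and B: "\<And>b. b \<in> Basis \<Longrightarrow> g b \<le> B" "\<And>b. b \<in> Basis \<Longrightarrow> g (- b) \<le> B"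
    and "B \<ge> 0"
  shows "g v \<le> real DIM('v) * B * norm v"
proof -
  have "g v = g (\<Sum>b\<in>Basis. (v \<bullet> b) *\<^sub>R b)" by (simp add: euclidean_representation)
  also have "\<dots> \<le> (\<Sum>b\<in>Basis. g ((v \<bullet> b) *\<^sub>R b))" by (rule sublinear_sum_le[OF g])
  also have "\<dots> \<le> (\<Sum>b\<in>(Basis::'v set). B * norm v)"
  proof (rule sum_mono)
    fix b :: 'v assume b: "b \<in> Basis"
    have "g ((v \<bullet> b) *\<^sub>R b) \<le> \<bar>v \<bullet> b\<bar> * B"
    proof (cases "v \<bullet> b \<ge> 0")
      case True
      then show ?thesis using sublinear_scale[OF g True, of b] B(1)[OF b] by (simp add: mult_left_mono)
    next
      case False
      then show ?thesis using sublinear_scale[OF g, of "- (v \<bullet> b)" "- b"] B(2)[OF b]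
        by (simp add: mult_left_mono_neg)
    qed
    also have "\<dots> \<le> norm v * B" using Basis_le_norm[OF b, of v] \<open>B \<ge> 0\<close> by (simp add: mult_right_mono)
    finally show "g ((v \<bullet> b) *\<^sub>R b) \<le> B * norm v" by (simp add: mult.commute)
  qed
  finally show ?thesis by simp
qed

text \<open>
  The test set consists of the signed basis vectors, where closeness to \<open>G\<close> gives all
  such \<open>g\<close> a common Lipschitz constant \<open>L\<close>, and of a finite subset of \<open>K\<close> whose balls of
  radius \<open>G s / (2 L)\<close> cover \<open>K\<close>. The tolerance \<open>e \<le> G s / 2\<close> gives \<open>g s > G s / 2\<close>, and \<open>g\<close> drops
  by less than \<open>G s / 2\<close> on that ball.
\<close>

lemma sublinear_positive_finite_test:
  fixes G :: "'v::euclidean_space \<Rightarrow> real"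
  assumes "compact K" and pos: "\<And>t. t \<in> K \<Longrightarrow> G t > 0"
  obtains T e where "finite T" "e > 0"
    "\<And>g t. sublinear g \<Longrightarrow> (\<And>s. s \<in> T \<Longrightarrow> \<bar>g s - G s\<bar> < e) \<Longrightarrow> t \<in> K \<Longrightarrow> g t > 0"
proof -
  define A :: "'v set" where "A = Basis \<union> uminus ` Basis"
  define B where "B = 1 + (\<Sum>b\<in>A. \<bar>G b\<bar>)"
  define L where "L = real DIM('v) * B"
  have A: "finite A" by (simp add: A_def)
  have "B \<ge> 1" by (simp add: B_def sum_nonneg)
  then have "L > 0" by (simp add: L_def)
  have GB: "G b + 1 \<le> B" if "b \<in> A" for b
    using member_le_sum[OF that, of "\<lambda>b. \<bar>G b\<bar>"] A by (auto simp: B_def)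
  obtain T' where T': "T' \<subseteq> K" "finite T'" "K \<subseteq> (\<Union>s\<in>T'. ball s (G s / (2 * L)))"
    using compactE_image[OF \<open>compact K\<close>, of K "\<lambda>s. ball s (G s / (2 * L))"] pos \<open>L > 0\<close> by force
  define e where "e = Min (insert 1 ((\<lambda>s. G s / 2) ` T'))"
  have "finite (insert 1 ((\<lambda>s. G s / 2) ` T'))" using T' by simp
  then have e: "e \<le> 1" "\<And>s. s \<in> T' \<Longrightarrow> e \<le> G s / 2"
    unfolding e_def by (blast intro: Min_le)+
  have "e > 0" using T' pos by (auto simp: e_def)
  show ?thesis
  proof (rule that)
    show "finite (A \<union> T')" "e > 0" using A T' \<open>e > 0\<close> by auto
    fix g :: "'v \<Rightarrow> real" and t
    assume g: "sublinear g" and close: "\<And>s. s \<in> A \<union> T' \<Longrightarrow> \<bar>g s - G s\<bar> < e" and "t \<in> K"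
    then obtain s where s: "s \<in> T'" "dist s t < G s / (2 * L)" using T' by auto
    have "g b \<le> B" if "b \<in> A" for b
      using close[of b] GB[OF that] e(1) that by auto
    then have "g (s - t) \<le> L * norm (s - t)"
      unfolding L_def using g \<open>B \<ge> 1\<close> by (intro sublinear_le_norm) (auto simp: A_def)
    also have "\<dots> < G s / 2" using s(2) \<open>L > 0\<close> by (simp add: dist_norm field_simps)
    also have "\<dots> < g s" using close[of s] e(2)[OF s(1)] s(1) by (auto simp: abs_less_iff)
    finally have "g (s - t) < g s" .
    then show "g t > 0" using sublinear_add[OF g, of t "s - t"] by simp
  qed
qed

section \<open>A weak law of large numbers\<close>

text \<open>After centring, independence makes the mixed terms of the squared sum vanish in expectation.\<close>

lemma (in prob_space) variance_sum_indep:
  fixes Y :: "'i \<Rightarrow> 'a \<Rightarrow> real"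
  assumes indep: "indep_vars (\<lambda>_. borel) Y I" and "finite I"
    and int: "\<And>i. i \<in> I \<Longrightarrow> integrable M (\<lambda>\<omega>. (Y i \<omega>)\<^sup>2)"
  shows "integrable M (\<lambda>\<omega>. (\<Sum>i\<in>I. Y i \<omega>)\<^sup>2)" (is ?int)
    and "variance (\<lambda>\<omega>. \<Sum>i\<in>I. Y i \<omega>) = (\<Sum>i\<in>I. variance (Y i))" (is ?var)
proof -
  have rv: "random_variable borel (Y i)" if "i \<in> I" for i
    using indep that by (auto simp: indep_vars_def)
  have int1: "integrable M (Y i)" if "i \<in> I" for i
    using square_integrable_imp_integrable[OF rv[OF that] int[OF that]] .
  define Z where "Z i \<omega> = Y i \<omega> - expectation (Y i)" for i \<omega>
  have cov: "integrable M (\<lambda>\<omega>. Z i \<omega> * Z j \<omega>)"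
      "expectation (\<lambda>\<omega>. Z i \<omega> * Z j \<omega>) = (if i = j then variance (Y i) else 0)"
      "integrable M (\<lambda>\<omega>. Y i \<omega> * Y j \<omega>)"
    if ij: "i \<in> I" "j \<in> I" for i j
  proof -
    have intZ: "integrable M (Z k)" "expectation (Z k) = 0" if "k \<in> I" for k
      using int1[OF that] by (auto simp: Z_def[abs_def] prob_space)
    have "integrable M (\<lambda>\<omega>. Z i \<omega> * Z j \<omega>) \<and> integrable M (\<lambda>\<omega>. Y i \<omega> * Y j \<omega>) \<and>
        expectation (\<lambda>\<omega>. Z i \<omega> * Z j \<omega>) = (if i = j then variance (Y i) else 0)"
    proof (cases "i = j")
      case True
      have YY: "integrable M (\<lambda>\<omega>. Y i \<omega> * Y i \<omega>)"
        using int[OF ij(1)] by (simp add: power2_eq_square)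
      have "integrable M (\<lambda>\<omega>. Z i \<omega> * Z i \<omega>)"
        unfolding Z_def left_diff_distrib right_diff_distrib
        by (intro Bochner_Integration.integrable_diff YY integrable_mult_left integrable_mult_right int1[OF ij(1)]) simp
      then show ?thesis using True YY by (simp add: Z_def power2_eq_square)
    next
      case False
      have indY: "indep_vars (\<lambda>_. borel) Y {i, j}"
        by (rule indep_vars_subset[OF indep]) (use ij in auto)
      have indZ: "indep_vars (\<lambda>_. borel) Z {i, j}"
        unfolding Z_def[abs_def] by (rule indep_vars_compose2[OF indY]) auto
      have "integrable M (\<lambda>\<omega>. \<Prod>k\<in>{i, j}. Y k \<omega>)"
        by (rule indep_vars_integrable[OF _ indY]) (use int1 ij in auto)
      moreover have "integrable M (\<lambda>\<omega>. \<Prod>k\<in>{i, j}. Z k \<omega>)"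
        by (rule indep_vars_integrable[OF _ indZ]) (use intZ ij in auto)
      moreover have "expectation (\<lambda>\<omega>. \<Prod>k\<in>{i, j}. Z k \<omega>) = (\<Prod>k\<in>{i, j}. expectation (Z k))"
        by (rule indep_vars_lebesgue_integral[OF _ indZ]) (use intZ ij in auto)
      ultimately show ?thesis using False intZ ij by simp
    qed
    then show "integrable M (\<lambda>\<omega>. Z i \<omega> * Z j \<omega>)"
      "expectation (\<lambda>\<omega>. Z i \<omega> * Z j \<omega>) = (if i = j then variance (Y i) else 0)"
      "integrable M (\<lambda>\<omega>. Y i \<omega> * Y j \<omega>)" by auto
  qed
  show ?int unfolding power2_eq_square sum_product using cov(3) by auto
  have "variance (\<lambda>\<omega>. \<Sum>i\<in>I. Y i \<omega>) = expectation (\<lambda>\<omega>. \<Sum>i\<in>I. \<Sum>j\<in>I. Z i \<omega> * Z j \<omega>)"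
    using int1 by (subst Bochner_Integration.integral_sum)
      (auto simp: Z_def power2_eq_square sum_product sum_subtractf simp flip: sum_subtractf)
  also have "\<dots> = (\<Sum>i\<in>I. \<Sum>j\<in>I. expectation (\<lambda>\<omega>. Z i \<omega> * Z j \<omega>))"
    using cov(1) by (subst Bochner_Integration.integral_sum;
      auto intro!: sum.cong Bochner_Integration.integral_sum)
  also have "\<dots> = (\<Sum>i\<in>I. \<Sum>j\<in>I. if i = j then variance (Y i) else 0)"
    by (intro sum.cong refl cov(2))
  also have "\<dots> = (\<Sum>i\<in>I. variance (Y i))" using \<open>finite I\<close> by simp
  finally show ?var .
qed

text \<open>
  Chebyshev's inequality applied to the sum, whose variance grows only linearly in \<open>n\<close>.
\<close>

lemma (in prob_space) weak_law_of_large_numbers: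
  fixes Y :: "nat \<Rightarrow> 'a \<Rightarrow> real"
  assumes indep: "indep_vars (\<lambda>_. borel) Y {1..}"
    and int: "\<And>i. i \<ge> 1 \<Longrightarrow> integrable M (\<lambda>\<omega>. (Y i \<omega>)\<^sup>2)"
    and mean: "\<And>i. i \<ge> 1 \<Longrightarrow> expectation (Y i) = \<mu>"
    and var: "\<And>i. i \<ge> 1 \<Longrightarrow> variance (Y i) = v"
    and "e > 0"
  shows "(\<lambda>n. prob {\<omega> \<in> space M. e \<le> \<bar>1 / real n * (\<Sum>i=1..n. Y i \<omega>) - \<mu>\<bar>}) \<longlonglongrightarrow> 0"
proof (rule tendsto_sandwich[where f = "\<lambda>_. 0"])
  show "(\<lambda>n. v / e\<^sup>2 / real n) \<longlonglongrightarrow> 0" by (rule lim_const_over_n)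
  show "\<forall>\<^sub>F n in sequentially. prob {\<omega> \<in> space M. e \<le> \<bar>1 / real n * (\<Sum>i=1..n. Y i \<omega>) - \<mu>\<bar>}
      \<le> v / e\<^sup>2 / real n"
    using eventually_gt_at_top[of 0]
  proof eventually_elim
    case (elim n)
    let ?S = "\<lambda>\<omega>. \<Sum>i=1..n. Y i \<omega>"
    have rv: "random_variable borel (Y i)" if "i \<in> {1..n}" for i
      using indep that by (auto simp: indep_vars_def)
    have int1: "integrable M (Y i)" if "i \<in> {1..n}" for i
      using square_integrable_imp_integrable[OF rv[OF that] int] that by auto
    have indep_n: "indep_vars (\<lambda>_. borel) Y {1..n}" using indep by (rule indep_vars_subset) auto
    have ES: "expectation ?S = n * \<mu>" using int1 mean by simp
    have "prob {\<omega> \<in> space M. e \<le> \<bar>1 / real n * ?S \<omega> - \<mu>\<bar>}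
        = prob {\<omega> \<in> space M. n * e \<le> \<bar>?S \<omega> - expectation ?S\<bar>}"
    proof -
      have "\<bar>1 / real n * ?S \<omega> - \<mu>\<bar> = \<bar>?S \<omega> - n * \<mu>\<bar> / n" for \<omega>
      proof -
        have "1 / real n * ?S \<omega> - \<mu> = (?S \<omega> - n * \<mu>) / n" using elim by (simp add: field_simps)
        then show ?thesis by simp
      qed
      then show ?thesis unfolding ES using elim by (simp add: pos_le_divide_eq mult.commute)
    qed
    also have "\<dots> \<le> variance ?S / (n * e)\<^sup>2"
      using elim \<open>e > 0\<close> int rv variance_sum_indep(1)[OF indep_n]
      by (intro Chebyshev_inequality borel_measurable_sum) auto
    also have "variance ?S = n * v"
      using variance_sum_indep(2)[OF indep_n] int var by simp
    also have "n * v / (n * e)\<^sup>2 = v / e\<^sup>2 / n" using elim by (simp add: power2_eq_square)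
    finally show ?case .
  qed
qed auto

section \<open>Directional derivatives of a random convex function\<close>

context
  fixes P :: "'e measure" and \<phi> :: "'e \<Rightarrow> 'v::euclidean_space \<Rightarrow> real" and S :: "'v set" and x :: 'v
  assumes P: "prob_space P"
    and meas: "\<And>y. y \<in> S \<Longrightarrow> (\<lambda>z. \<phi> z y) \<in> borel_measurable P"
    and conv: "\<And>z. z \<in> space P \<Longrightarrow> convex_on S (\<phi> z)"
    and L2: "\<And>y. y \<in> S \<Longrightarrow> integrable P (\<lambda>z. (\<phi> z y)\<^sup>2)"
    and S: "open S" "x \<in> S"
begin

text \<open>
  Measurability and dominated convergence need a sequence rather than the filter of all small
  steps. The first step is the largest one, so that the quotient at \<open>\<epsilon> 0\<close> bounds all the others
  from above and the backward quotient with the same step bounds them from below.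
\<close>

lemma small_step_sequence:
  obtains \<epsilon> :: "nat \<Rightarrow> real" where "\<And>k. 0 < \<epsilon> k" "\<And>k. \<epsilon> k \<le> \<epsilon> 0" "\<And>k. x + \<epsilon> k *\<^sub>R t \<in> S" "x - \<epsilon> 0 *\<^sub>R t \<in> S"
    "\<And>z. z \<in> space P \<Longrightarrow> (\<lambda>k. (\<phi> z (x + \<epsilon> k *\<^sub>R t) - \<phi> z x) / \<epsilon> k) \<longlonglongrightarrow> dir_deriv (\<phi> z) x t"
proof -
  obtain \<eta> where \<eta>: "\<eta> > 0" "\<And>\<epsilon>. \<bar>\<epsilon>\<bar> \<le> \<eta> \<Longrightarrow> x + \<epsilon> *\<^sub>R t \<in> S"
    using open_contains_small_segment S by blast
  let ?\<epsilon> = "\<lambda>k. \<eta> / real (Suc k)"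
  have "filterlim ?\<epsilon> (at_right 0) sequentially"
    unfolding filterlim_at using \<eta>(1)
    by (auto intro!: LIMSEQ_Suc lim_const_over_n simp del: of_nat_Suc)
  then have lim: "(\<lambda>k. (\<phi> z (x + ?\<epsilon> k *\<^sub>R t) - \<phi> z x) / ?\<epsilon> k) \<longlonglongrightarrow> dir_deriv (\<phi> z) x t"
    if "z \<in> space P" for z
    using filterlim_compose[OF tendsto_dir_deriv[OF conv[OF that] S]] by blast
  have le: "?\<epsilon> k \<le> \<eta>" "0 < ?\<epsilon> k" for k
    using \<eta>(1) by (auto simp: divide_le_eq)
  show ?thesis
  proof (rule that[of ?\<epsilon>])
    show "?\<epsilon> k \<le> ?\<epsilon> 0" for k using le(1) by simp
    show "x + ?\<epsilon> k *\<^sub>R t \<in> S" for k using le[of k] by (intro \<eta>(2)) linarith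
    show "x - ?\<epsilon> 0 *\<^sub>R t \<in> S" using \<eta>(2)[of "- \<eta>"] \<eta>(1) by simp
  qed (use le lim in blast)+
qed

lemma measurable_dir_deriv: "(\<lambda>z. dir_deriv (\<phi> z) x t) \<in> borel_measurable P"
proof -
  obtain \<epsilon> :: "nat \<Rightarrow> real" where \<epsilon>: "\<And>k. 0 < \<epsilon> k" "\<And>k. \<epsilon> k \<le> \<epsilon> 0" "\<And>k. x + \<epsilon> k *\<^sub>R t \<in> S" "x - \<epsilon> 0 *\<^sub>R t \<in> S"
    "\<And>z. z \<in> space P \<Longrightarrow> (\<lambda>k. (\<phi> z (x + \<epsilon> k *\<^sub>R t) - \<phi> z x) / \<epsilon> k) \<longlonglongrightarrow> dir_deriv (\<phi> z) x t"
    by (rule small_step_sequence[of t]) (rule that)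
  show ?thesis
    by (rule borel_measurable_LIMSEQ_real[OF \<epsilon>(5)])
      (use meas \<epsilon>(3) S in \<open>auto intro!: borel_measurable_divide borel_measurable_diff\<close>)
qed

lemma square_integrable_difference_quotient:
  assumes "y \<in> S" "y' \<in> S"
  shows "integrable P (\<lambda>z. ((\<phi> z y - \<phi> z y') / \<eta>)\<^sup>2)"
proof -
  have "integrable P (\<lambda>z. (\<phi> z y - \<phi> z y')\<^sup>2)"
  proof (rule Bochner_Integration.integrable_bound)
    show "integrable P (\<lambda>z. 2 * (\<phi> z y)\<^sup>2 + 2 * (\<phi> z y')\<^sup>2)" using L2 assms by auto
    show "AE z in P. norm ((\<phi> z y - \<phi> z y')\<^sup>2) \<le> norm (2 * (\<phi> z y)\<^sup>2 + 2 * (\<phi> z y')\<^sup>2)"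
    proof (intro AE_I2)
      fix z
      have "2 * (\<phi> z y)\<^sup>2 + 2 * (\<phi> z y')\<^sup>2 - (\<phi> z y - \<phi> z y')\<^sup>2 = (\<phi> z y + \<phi> z y')\<^sup>2"
        by (simp add: power2_eq_square algebra_simps)
      then have "(\<phi> z y - \<phi> z y')\<^sup>2 \<le> 2 * (\<phi> z y)\<^sup>2 + 2 * (\<phi> z y')\<^sup>2"
        using zero_le_power2[of "\<phi> z y + \<phi> z y'"] by linarith
      then show "norm ((\<phi> z y - \<phi> z y')\<^sup>2) \<le> norm (2 * (\<phi> z y)\<^sup>2 + 2 * (\<phi> z y')\<^sup>2)"
        by simp
    qed
  qed (use meas assms in \<open>auto intro!: borel_measurable_power borel_measurable_diff\<close>)
  then show ?thesis by (simp add: power_divide)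
qed

text \<open>
  The derivative lies between a backward and a forward difference quotient of fixed step.
\<close>

lemma square_integrable_dir_deriv: "integrable P (\<lambda>z. (dir_deriv (\<phi> z) x t)\<^sup>2)"
proof -
  obtain \<epsilon> :: "nat \<Rightarrow> real" where \<epsilon>: "\<And>k. 0 < \<epsilon> k" "\<And>k. \<epsilon> k \<le> \<epsilon> 0" "\<And>k. x + \<epsilon> k *\<^sub>R t \<in> S" "x - \<epsilon> 0 *\<^sub>R t \<in> S"
    "\<And>z. z \<in> space P \<Longrightarrow> (\<lambda>k. (\<phi> z (x + \<epsilon> k *\<^sub>R t) - \<phi> z x) / \<epsilon> k) \<longlonglongrightarrow> dir_deriv (\<phi> z) x t"
    by (rule small_step_sequence[of t]) (rule that)
  let ?a = "\<lambda>z. (\<phi> z x - \<phi> z (x - \<epsilon> 0 *\<^sub>R t)) / \<epsilon> 0"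
  let ?b = "\<lambda>z. (\<phi> z (x + \<epsilon> 0 *\<^sub>R t) - \<phi> z x) / \<epsilon> 0"
  show ?thesis
  proof (rule Bochner_Integration.integrable_bound)
    show "integrable P (\<lambda>z. (?a z)\<^sup>2 + (?b z)\<^sup>2)"
      using \<epsilon>(3)[of 0] \<epsilon>(4) S(2)
      by (intro Bochner_Integration.integrable_add square_integrable_difference_quotient)
    show "AE z in P. norm ((dir_deriv (\<phi> z) x t)\<^sup>2) \<le> norm ((?a z)\<^sup>2 + (?b z)\<^sup>2)"
    proof (intro AE_I2)
      fix z assume z: "z \<in> space P"
      have "?a z \<le> dir_deriv (\<phi> z) x t" "dir_deriv (\<phi> z) x t \<le> ?b z"
        using dir_deriv_ge_difference_quotient[OF conv[OF z] S] 
          dir_deriv_le_difference_quotient[OF conv[OF z] S] \<epsilon> by auto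
      then have "\<bar>dir_deriv (\<phi> z) x t\<bar> \<le> \<bar>?a z\<bar> \<or> \<bar>dir_deriv (\<phi> z) x t\<bar> \<le> \<bar>?b z\<bar>"
        by linarith
      then have "(dir_deriv (\<phi> z) x t)\<^sup>2 \<le> (?a z)\<^sup>2 \<or> (dir_deriv (\<phi> z) x t)\<^sup>2 \<le> (?b z)\<^sup>2"
        by (simp only: abs_le_square_iff)
      then have "(dir_deriv (\<phi> z) x t)\<^sup>2 \<le> (?a z)\<^sup>2 + (?b z)\<^sup>2"
        using zero_le_power2[of "?a z"] zero_le_power2[of "?b z"] by linarith
      then show "norm ((dir_deriv (\<phi> z) x t)\<^sup>2) \<le> norm ((?a z)\<^sup>2 + (?b z)\<^sup>2)"
        by simp
    qed
  qed (auto intro!: borel_measurable_power measurable_dir_deriv)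
qed

text \<open>
  Each difference quotient of the risk is at least \<open>u \<bullet> t\<close>. Dominated convergence exchanges
  the limit of the quotients with the expectation.
\<close>

lemma expectation_dir_deriv_ge:
  assumes u: "u \<in> subdifferential S (\<lambda>y. \<integral>z. \<phi> z y \<partial>P) x"
  shows "u \<bullet> t \<le> (\<integral>z. dir_deriv (\<phi> z) x t \<partial>P)"
proof -
  interpret prob_space P by (rule P)
  have L1: "integrable P (\<lambda>z. \<phi> z y)" if "y \<in> S" for y
    using square_integrable_imp_integrable[OF meas L2] that by blast
  obtain \<epsilon> :: "nat \<Rightarrow> real" where \<epsilon>: "\<And>k. 0 < \<epsilon> k" "\<And>k. \<epsilon> k \<le> \<epsilon> 0" "\<And>k. x + \<epsilon> k *\<^sub>R t \<in> S" "x - \<epsilon> 0 *\<^sub>R t \<in> S"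
    "\<And>z. z \<in> space P \<Longrightarrow> (\<lambda>k. (\<phi> z (x + \<epsilon> k *\<^sub>R t) - \<phi> z x) / \<epsilon> k) \<longlonglongrightarrow> dir_deriv (\<phi> z) x t"
    by (rule small_step_sequence[of t]) (rule that)
  let ?q = "\<lambda>k z. (\<phi> z (x + \<epsilon> k *\<^sub>R t) - \<phi> z x) / \<epsilon> k"
  let ?a = "\<lambda>z. (\<phi> z x - \<phi> z (x - \<epsilon> 0 *\<^sub>R t)) / \<epsilon> 0"
  have "(\<lambda>k. \<integral>z. ?q k z \<partial>P) \<longlonglongrightarrow> (\<integral>z. dir_deriv (\<phi> z) x t \<partial>P)"
  proof (rule integral_dominated_convergence[where w = "\<lambda>z. \<bar>?a z\<bar> + \<bar>?q 0 z\<bar>"])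
    show "integrable P (\<lambda>z. \<bar>?a z\<bar> + \<bar>?q 0 z\<bar>)"
      using \<epsilon> S L1 by (intro Bochner_Integration.integrable_add integrable_abs integrable_divide Bochner_Integration.integrable_diff) auto
    show "AE z in P. norm (?q k z) \<le> \<bar>?a z\<bar> + \<bar>?q 0 z\<bar>" for k
    proof (intro AE_I2)
      fix z assume z: "z \<in> space P"
      have "?q k z \<le> ?q 0 z" "?a z \<le> ?q k z"
        using convex_on_difference_quotient_mono[OF conv[OF z]]
          convex_on_difference_quotient_ge[OF conv[OF z]] \<epsilon> S by auto
      then show "norm (?q k z) \<le> \<bar>?a z\<bar> + \<bar>?q 0 z\<bar>" unfolding real_norm_def by linarith
    qed
  qed (use \<epsilon> S meas measurable_dir_deriv in \<open>auto intro!: borel_measurable_divide borel_measurable_diff\<close>)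
  moreover have "u \<bullet> t \<le> (\<integral>z. ?q k z \<partial>P)" for k
  proof -
    have "(\<integral>z. \<phi> z x \<partial>P) + u \<bullet> (\<epsilon> k *\<^sub>R t) \<le> (\<integral>z. \<phi> z (x + \<epsilon> k *\<^sub>R t) \<partial>P)"
      using u \<epsilon>(3)[of k] unfolding subdifferential_def by force
    then have "\<epsilon> k * (u \<bullet> t) \<le> (\<integral>z. \<phi> z (x + \<epsilon> k *\<^sub>R t) - \<phi> z x \<partial>P)"
      using L1 \<epsilon>(3)[of k] S(2) by (subst Bochner_Integration.integral_diff) auto
    then show ?thesis using \<epsilon>(1)[of k] by (simp add: pos_le_divide_eq mult.commute)
  qed
  ultimately show ?thesis by (intro LIMSEQ_le_const) auto
qed

end

section \<open>Convex M-estimation at a sharp minimizer\<close>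

text \<open>
  Convexity of \<open>G\<close> keeps the whole segment from \<open>x\<close> to \<open>y\<close> in \<open>G\<close>, so every point of \<open>G\<close> is seen
  from \<open>x\<close> in a direction of the tangent cone, however far away it is.
\<close>

lemma diff_in_tangent_cone:
  assumes "convex G" "x \<in> G" "y \<in> G" "c > 0"
  shows "c *\<^sub>R (y - x) \<in> tangent_cone G x"
  unfolding tangent_cone_def mem_Collect_eq
proof -
  have "\<forall>\<^sub>F \<epsilon> in at_right 0. \<epsilon> \<in> {0<..<1 / c}"
    using \<open>c > 0\<close> by (intro eventually_at_right_real) auto
  then show "\<forall>\<^sub>F \<epsilon> in at_right 0. x + \<epsilon> *\<^sub>R c *\<^sub>R (y - x) \<in> G"
  proof eventually_elim
    case (elim \<epsilon>)
    then have "(1 - \<epsilon> * c) *\<^sub>R x + (\<epsilon> * c) *\<^sub>R y \<in> G"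
      using assms by (intro convexD_alt) (auto simp: field_simps)
    then show ?case by (simp add: algebra_simps)
  qed
qed

lemma sublinear_average:
  assumes "\<And>i. i \<in> I \<Longrightarrow> sublinear (g i)" "c \<ge> 0"
  shows "sublinear (\<lambda>t. c * (\<Sum>i\<in>I. g i t))"
  unfolding sublinear_def
proof (intro conjI allI impI)
  fix s t
  have "(\<Sum>i\<in>I. g i (s + t)) \<le> (\<Sum>i\<in>I. g i s) + (\<Sum>i\<in>I. g i t)"
    unfolding sum.distrib[symmetric] by (intro sum_mono sublinear_add assms)
  then show "c * (\<Sum>i\<in>I. g i (s + t)) \<le> c * (\<Sum>i\<in>I. g i s) + c * (\<Sum>i\<in>I. g i t)"
    using \<open>c \<ge> 0\<close> by (simp add: mult_left_mono flip: distrib_left)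
next
  fix a :: real and t assume "a \<ge> 0"
  then have "(\<Sum>i\<in>I. g i (a *\<^sub>R t)) = a * (\<Sum>i\<in>I. g i t)"
    unfolding sum_distrib_left by (intro sum.cong refl sublinear_scale assms)
  then show "c * (\<Sum>i\<in>I. g i (a *\<^sub>R t)) = a * (c * (\<Sum>i\<in>I. g i t))" by simp
qed

theorem theorem6:
  fixes M :: "'w measure" and E P :: "'e measure"
    and X :: "nat \<Rightarrow> 'w \<Rightarrow> 'e"
    and \<phi> :: "'e \<Rightarrow> real ^ 'd \<Rightarrow> real"
    and \<Theta>\<^sub>0 \<Theta> C :: "(real ^ 'd) set"
    and \<theta>s :: "real ^ 'd"
    and \<theta>hat :: "nat \<Rightarrow> 'w \<Rightarrow> real ^ 'd"
  assumes "prob_space M"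
    and X_indep: "prob_space.indep_vars M (\<lambda>_. E) X {1..}"
    and X_distr: "\<And>i. i \<ge> 1 \<Longrightarrow> distr M E (X i) = P"
    and "open \<Theta>\<^sub>0" and "convex \<Theta>\<^sub>0"
    and "closed \<Theta>" and "convex \<Theta>" and "\<Theta> \<subseteq> \<Theta>\<^sub>0"
    and \<phi>_measurable: "\<And>\<theta>. \<theta> \<in> \<Theta>\<^sub>0 \<Longrightarrow> (\<lambda>x. \<phi> x \<theta>) \<in> borel_measurable E"
    and \<phi>_convex: "\<And>x. x \<in> space E \<Longrightarrow> convex_on \<Theta>\<^sub>0 (\<phi> x)"
    and \<phi>_L1: "\<And>\<theta>. \<theta> \<in> \<Theta>\<^sub>0 \<Longrightarrow> integrable P (\<lambda>x. \<phi> x \<theta>)"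
    and minimizer: "is_arg_min (risk M X \<phi>) (\<lambda>\<theta>. \<theta> \<in> \<Theta>) \<theta>s"
    and unique: "\<And>\<theta>. is_arg_min (risk M X \<phi>) (\<lambda>\<theta>. \<theta> \<in> \<Theta>) \<theta> \<Longrightarrow> \<theta> = \<theta>s"
    and C: "C = support_cone \<Theta> \<theta>s"
    and \<theta>hat_rv: "\<And>n. n \<ge> 1 \<Longrightarrow> prob_space.random_variable M borel (\<theta>hat n)"
    and \<theta>hat_values: "\<And>n \<omega>. n \<ge> 1 \<Longrightarrow> \<omega> \<in> space M \<Longrightarrow> \<theta>hat n \<omega> \<in> \<Theta>"
    and \<theta>hat_minimizer: "AE \<omega> in M. \<forall>\<^sub>F n in sequentially.
          is_arg_min (empirical_risk X \<phi> n \<omega>) (\<lambda>\<theta>. \<theta> \<in> \<Theta>) (\<theta>hat n \<omega>)"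
    and \<phi>_L2: "\<And>\<theta>. \<theta> \<in> \<Theta>\<^sub>0 \<Longrightarrow> integrable P (\<lambda>x. (\<phi> x \<theta>)\<^sup>2)"
    and positive: "\<And>t. t \<in> C - {0} \<Longrightarrow>
          support_function (subdifferential \<Theta>\<^sub>0 (risk M X \<phi>) \<theta>s) t > 0"
  shows "(\<lambda>n. prob_space.prob M {\<omega> \<in> space M. \<theta>hat n \<omega> = \<theta>s}) \<longlonglongrightarrow> 1"
proof -
  interpret prob_space M by fact
  have rvX: "X i \<in> measurable M E" if "i \<ge> 1" for i
    using X_indep that by (auto simp: indep_vars_def)
  have P_def: "P = distr M E (X 1)" using X_distr[of 1] by simp
  have P: "prob_space P" unfolding P_def using rvX[of 1] by (intro prob_space_distr) simp
  have sP: "space P = space E" "sets P = sets E" by (simp_all add: P_def)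
  have XE: "X i \<omega> \<in> space E" if "i \<ge> 1" "\<omega> \<in> space M" for i \<omega>
    using measurable_space[OF rvX] that by blast
  have \<theta>s: "\<theta>s \<in> \<Theta>" "\<theta>s \<in> \<Theta>\<^sub>0" using minimizer \<open>\<Theta> \<subseteq> \<Theta>\<^sub>0\<close> by (auto simp: is_arg_min_def)
  have meas: "(\<lambda>z. \<phi> z y) \<in> borel_measurable P" if "y \<in> \<Theta>\<^sub>0" for y
    using \<phi>_measurable[OF that] measurable_cong_sets[OF sP(2) refl] by blast
  have conv: "convex_on \<Theta>\<^sub>0 (\<phi> z)" if "z \<in> space P" for z using \<phi>_convex that sP by simp
  note ctx = P meas conv \<phi>_L2 \<open>open \<Theta>\<^sub>0\<close> \<theta>s(2)

  define D where "D t z = dir_deriv (\<phi> z) \<theta>s t" for t z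
  define G where "G t = (\<integral>z. D t z \<partial>P)" for t
  define g where "g n \<omega> t = 1 / real n * (\<Sum>i=1..n. D t (X i \<omega>))" for n \<omega> t
  have measD: "D t \<in> borel_measurable E" for t
    using measurable_dir_deriv[OF ctx] measurable_cong_sets[OF sP(2) refl] unfolding D_def[abs_def] by blast

  have risk: "risk M X \<phi> y = (\<integral>z. \<phi> z y \<partial>P)" if "y \<in> \<Theta>\<^sub>0" for y
    unfolding risk_def P_def using rvX[of 1] \<phi>_measurable[OF that] by (subst integral_distr) auto
  have Gpos: "G t > 0" if t: "t \<in> C - {0}" for t
  proof -
    obtain u where u: "u \<in> subdifferential \<Theta>\<^sub>0 (risk M X \<phi>) \<theta>s" "u \<bullet> t > 0"
      using positive[OF t] by (auto simp: support_function_def less_SUP_iff)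
    then have "u \<in> subdifferential \<Theta>\<^sub>0 (\<lambda>y. \<integral>z. \<phi> z y \<partial>P) \<theta>s"
      using risk \<theta>s by (auto simp: subdifferential_def)
    from expectation_dir_deriv_ge[OF ctx this] u(2) show ?thesis
      unfolding G_def D_def by (meson less_le_trans)
  qed

  define K where "K = C \<inter> sphere 0 1"
  have "compact K" unfolding K_def C support_cone_def by (intro closed_Int_compact) auto
  moreover have "G t > 0" if "t \<in> K" for t using that by (intro Gpos) (auto simp: K_def)
  ultimately obtain T e where T: "finite T" "e > 0"
    and Te: "\<And>h t. sublinear h \<Longrightarrow> (\<And>s. s \<in> T \<Longrightarrow> \<bar>h s - G s\<bar> < e) \<Longrightarrow> t \<in> K \<Longrightarrow> h t > 0"
    using sublinear_positive_finite_test[of K G] by blast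

  \<comment> \<open>the event that the law of large numbers has not yet taken hold at the test point \<open>t\<close>\<close>
  define B where "B n t = {\<omega> \<in> space M. e \<le> \<bar>g n \<omega> t - G t\<bar>}" for n t
  have [measurable]: "(\<lambda>\<omega>. g n \<omega> t) \<in> borel_measurable M" for n t
    unfolding g_def using measurable_compose[OF rvX measD]
    by (intro borel_measurable_times borel_measurable_sum) auto
  have B_sets: "B n t \<in> events" for n t unfolding B_def by measurable
  have B_lim: "(\<lambda>n. prob (B n t)) \<longlonglongrightarrow> 0" for t
    unfolding B_def g_def
  proof (rule weak_law_of_large_numbers)
    show "indep_vars (\<lambda>_. borel) (\<lambda>i \<omega>. D t (X i \<omega>)) {1..}"
      using indep_vars_compose2[OF X_indep, of "\<lambda>_. D t" "\<lambda>_. borel"] measD by simp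
    fix i :: nat assume i: "i \<ge> 1"
    have "integrable P (\<lambda>z. (D t z)\<^sup>2)"
      unfolding D_def by (rule square_integrable_dir_deriv[OF ctx])
    then show "integrable M (\<lambda>\<omega>. (D t (X i \<omega>))\<^sup>2)"
      unfolding X_distr[OF i, symmetric] using rvX[OF i] measD by (subst (asm) integrable_distr_eq) auto
    have *: "expectation (\<lambda>\<omega>. h (X i \<omega>)) = (\<integral>z. h z \<partial>P)" if "h \<in> borel_measurable E" for h :: "_ \<Rightarrow> real"
      unfolding X_distr[OF i, symmetric] using rvX[OF i] that by (subst integral_distr) auto
    show m: "expectation (\<lambda>\<omega>. D t (X i \<omega>)) = G t" using *[OF measD] by (simp add: G_def)
    show "variance (\<lambda>\<omega>. D t (X i \<omega>)) = (\<integral>z. (D t z - G t)\<^sup>2 \<partial>P)"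
      unfolding m using measD by (intro *) auto
  qed (rule \<open>e > 0\<close>)

  define N where "N n = {\<omega> \<in> space M. \<theta>hat n \<omega> \<noteq> \<theta>s}" for n
  have N_sets: "N n \<in> events" if "n \<ge> 1" for n
    using \<theta>hat_rv[OF that] unfolding N_def by measurable
  \<comment> \<open>by \<open>sharp\<close>, on this event the estimator cannot be a minimizer of the empirical risk\<close>
  define F where "F n = N n - (\<Union>t\<in>T. B n t)" for n
  \<comment> \<open>when all test points are good, \<open>\<theta>s\<close> is the strict global minimizer of the empirical risk\<close>
  have sharp: "empirical_risk X \<phi> n \<omega> \<theta>s < empirical_risk X \<phi> n \<omega> \<theta>"
    if n: "n \<ge> 1" and \<omega>: "\<omega> \<in> space M" "\<omega> \<notin> (\<Union>t\<in>T. B n t)" and \<theta>: "\<theta> \<in> \<Theta>" "\<theta> \<noteq> \<theta>s" for n \<omega> \<theta>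
  proof -
    have subD: "sublinear (\<lambda>t. D t (X i \<omega>))" if "i \<ge> 1" for i
      unfolding D_def
      by (rule sublinear_dir_deriv[OF \<phi>_convex[OF XE[OF that \<omega>(1)]] \<open>open \<Theta>\<^sub>0\<close> \<theta>s(2)])
    have subg: "sublinear (g n \<omega>)"
      unfolding g_def[abs_def] by (intro sublinear_average subD) auto
    define r where "r = norm (\<theta> - \<theta>s)"
    define t where "t = (1 / r) *\<^sub>R (\<theta> - \<theta>s)"
    have r: "r > 0" using \<theta> by (simp add: r_def)
    have "t \<in> tangent_cone \<Theta> \<theta>s"
      unfolding t_def using \<open>convex \<Theta>\<close> \<theta>s \<theta> r by (intro diff_in_tangent_cone) auto
    then have "t \<in> K" using r closure_subset by (auto simp: K_def C support_cone_def t_def r_def)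
    have "g n \<omega> t > 0"
      using \<omega> by (intro Te[OF subg _ \<open>t \<in> K\<close>]) (auto simp: B_def not_le)
    have \<theta>_eq: "\<theta> = \<theta>s + r *\<^sub>R t" using r by (simp add: t_def)
    have "r * g n \<omega> t = 1 / real n * (\<Sum>i=1..n. r * D t (X i \<omega>))"
      by (simp add: g_def sum_distrib_left)
    also have "\<dots> \<le> 1 / real n * (\<Sum>i=1..n. \<phi> (X i \<omega>) \<theta> - \<phi> (X i \<omega>) \<theta>s)"
    proof (intro mult_left_mono sum_mono)
      fix i assume "i \<in> {1..n}"
      then have cv: "convex_on \<Theta>\<^sub>0 (\<phi> (X i \<omega>))" using XE \<omega> by (intro \<phi>_convex) auto
      have "D t (X i \<omega>) \<le> (\<phi> (X i \<omega>) (\<theta>s + r *\<^sub>R t) - \<phi> (X i \<omega>) \<theta>s) / r"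
        unfolding D_def using \<theta> \<open>\<Theta> \<subseteq> \<Theta>\<^sub>0\<close> \<theta>_eq r
        by (intro dir_deriv_le_difference_quotient[OF cv \<open>open \<Theta>\<^sub>0\<close> \<theta>s(2)]) auto
      then show "r * D t (X i \<omega>) \<le> \<phi> (X i \<omega>) \<theta> - \<phi> (X i \<omega>) \<theta>s"
        using r \<theta>_eq by (simp add: pos_le_divide_eq mult.commute)
    qed simp
    also have "\<dots> = empirical_risk X \<phi> n \<omega> \<theta> - empirical_risk X \<phi> n \<omega> \<theta>s"
      by (simp add: empirical_risk_def sum_subtractf right_diff_distrib diff_divide_distrib)
    finally show ?thesis using mult_pos_pos[OF r \<open>g n \<omega> t > 0\<close>] by linarith
  qed

  have F_sets: "F n \<in> events" if "n \<ge> 1" for n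
    unfolding F_def using N_sets[OF that] B_sets T by auto
  \<comment> \<open>the index is shifted because measurability of \<open>\<theta>hat n\<close> is available for \<open>n \<ge> 1\<close> only\<close>
  have "(\<lambda>n. \<integral>\<omega>. indicator (F (Suc n)) \<omega> \<partial>M) \<longlonglongrightarrow> (\<integral>\<omega>. (0::real) \<partial>M)"
  proof (rule integral_dominated_convergence[where w = "\<lambda>_. 1"])
    show "AE \<omega> in M. (\<lambda>n. indicator (F (Suc n)) \<omega>) \<longlonglongrightarrow> (0::real)"
      using \<theta>hat_minimizer AE_space
    proof eventually_elim
      case (elim \<omega>)
      have "\<forall>\<^sub>F n in sequentially. \<omega> \<notin> F n"
        using elim(1) eventually_ge_at_top[of 1]
      proof eventually_elim
        case (elim n)
        show ?case
        proof
          assume "\<omega> \<in> F n"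
          then have "empirical_risk X \<phi> n \<omega> \<theta>s < empirical_risk X \<phi> n \<omega> (\<theta>hat n \<omega>)"
            using \<theta>hat_values[OF elim(2)] by (intro sharp elim(2)) (auto simp: F_def N_def)
          then show False using elim(1) \<theta>s(1) by (auto simp: is_arg_min_def)
        qed
      qed
      then have "\<forall>\<^sub>F n in sequentially. indicator (F n) \<omega> = (0::real)"
        by (auto elim: eventually_mono)
      then show ?case by (intro LIMSEQ_Suc tendsto_eventually)
    qed
  qed (use F_sets in auto)
  then have F_lim: "(\<lambda>n. prob (F n)) \<longlonglongrightarrow> 0"
    by - (rule LIMSEQ_imp_Suc, simp add: F_sets)
  have "(\<lambda>n. prob (N n)) \<longlonglongrightarrow> 0"
  proof (rule tendsto_sandwich[where f = "\<lambda>_. 0"])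
    show "(\<lambda>n. prob (F n) + (\<Sum>t\<in>T. prob (B n t))) \<longlonglongrightarrow> 0"
      using tendsto_add[OF F_lim tendsto_sum[of T "\<lambda>t n. prob (B n t)" "\<lambda>_. 0"]] B_lim by simp
    show "\<forall>\<^sub>F n in sequentially. prob (N n) \<le> prob (F n) + (\<Sum>t\<in>T. prob (B n t))"
      using eventually_ge_at_top[of 1]
    proof eventually_elim
      case (elim n)
      have "prob (N n) \<le> prob (F n \<union> (\<Union>t\<in>T. B n t))"
        using F_sets[OF elim] B_sets T
        by (intro finite_measure_mono sets.Un sets.finite_UN) (auto simp: F_def)
      also have "\<dots> \<le> prob (F n) + prob (\<Union>t\<in>T. B n t)"
        using F_sets[OF elim] B_sets T by (intro measure_Un_le sets.finite_UN) auto
      also have "prob (\<Union>t\<in>T. B n t) \<le> (\<Sum>t\<in>T. prob (B n t))"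
        using B_sets T by (intro finite_measure_subadditive_finite) auto
      finally show ?case by simp
    qed
  qed auto
  then have "(\<lambda>n. 1 - prob (N n)) \<longlonglongrightarrow> 1 - 0" by (intro tendsto_diff tendsto_const)
  moreover have "\<forall>\<^sub>F n in sequentially. 1 - prob (N n) = prob {\<omega> \<in> space M. \<theta>hat n \<omega> = \<theta>s}"
    using eventually_ge_at_top[of 1]
  proof eventually_elim
    case (elim n)
    have "{\<omega> \<in> space M. \<theta>hat n \<omega> = \<theta>s} = space M - N n" by (auto simp: N_def)
    then show ?case using prob_compl[OF N_sets[OF elim]] by simp
  qed
  ultimately show ?thesis by (auto intro: Lim_transform_eventually)
qed

end
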